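(* Let $X$ be a Tychonoff space which has the finitely supported Josefson--Nissenzweig property. Then $X$ admits a disjointly supported fsJN-sequence, i.e. there is an fsJN-sequence $\langle \mu_n\colon n\in\omega\rangle$ on $X$ such that $\mathrm{supp}(\mu_n)\cap\mathrm{supp}(\mu_{n'})=\emptyset$ for all $n\neq n'$ in $\omega$.
   Context: A measure on a Tychonoff space $X$ is a signed $\sigma$-additive Radon measure on the Borel $\sigma$-algebra of $X$; $\|\mu\|$ denotes its total variation norm, $\|\mu\|=\sup\{|\mu(A)|+|\mu(B)|\colon A,B\subseteq X \text{ Borel and disjoint}\}$, and $\mathrm{supp}(\mu)$ is its support. $C(X)$ is the set of all continuous real-valued functions on $X$. A Josefson--Nissenzweig sequence (JN-sequence) on $X$ is a sequence $\langle\mu_n\colon n\in\omega\rangle$ of measures on $X$ with $\|\mu_n\|=1$ for every $n\in\omega$ and $\lim_{n\to\infty}\int_X f\,d\mu_n=0$ for every $f\in C(X)$. An fsJN-sequence is a JN-sequence such that every $\mu_n$ has finite support. $X$ has the finitely supported Josefson--Nissenzweig property (fsJNP) if $X$ admits an fsJN-sequence. *)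

theory Defs
  imports "HOL-Analysis.Analysis"
begin

definition Tychonoff_space :: "'a topology \<Rightarrow> bool" where
  "Tychonoff_space X \<longleftrightarrow> completely_regular_space X \<and> Hausdorff_space X"

definition borel_of :: "'a topology \<Rightarrow> 'a measure" where
  "borel_of X = sigma (topspace X) {U. openin X U}"

text \<open>
  A signed measure is represented by a real-valued set function; only its values on the Borel
  subsets of the space matter.
\<close>

definition signed_measure :: "'a topology \<Rightarrow> ('a set \<Rightarrow> real) \<Rightarrow> bool" where
  "signed_measure X \<mu> \<longleftrightarrow> \<mu> {} = 0 \<and>
     (\<forall>A :: nat \<Rightarrow> 'a set. range A \<subseteq> sets (borel_of X) \<longrightarrow> disjoint_family A \<longrightarrow>
        (\<lambda>i. \<mu> (A i)) sums \<mu> (\<Union>i. A i))"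

text \<open>The variation $|\mu|(E)$, taken in the extended non-negative reals.\<close>

definition variation :: "'a topology \<Rightarrow> ('a set \<Rightarrow> real) \<Rightarrow> 'a set \<Rightarrow> ennreal" where
  "variation X \<mu> E =
     (SUP (A, B) \<in> {(A, B). A \<in> sets (borel_of X) \<and> B \<in> sets (borel_of X) \<and>
                            A \<subseteq> E \<and> B \<subseteq> E \<and> A \<inter> B = {}}.
        ennreal (\<bar>\<mu> A\<bar> + \<bar>\<mu> B\<bar>))"

definition variation_norm :: "'a topology \<Rightarrow> ('a set \<Rightarrow> real) \<Rightarrow> ennreal" where
  "variation_norm X \<mu> = variation X \<mu> (topspace X)"

definition signed_radon_measure :: "'a topology \<Rightarrow> ('a set \<Rightarrow> real) \<Rightarrow> bool" where
  "signed_radon_measure X \<mu> \<longleftrightarrow> signed_measure X \<mu> \<and>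
     (\<forall>E \<in> sets (borel_of X). \<forall>\<epsilon>::real. \<epsilon> > 0 \<longrightarrow>
        (\<exists>K. compactin X K \<and> K \<subseteq> E \<and> variation X \<mu> (E - K) < ennreal \<epsilon>))"

definition supp :: "'a topology \<Rightarrow> ('a set \<Rightarrow> real) \<Rightarrow> 'a set" where
  "supp X \<mu> = {x \<in> topspace X. \<forall>U. openin X U \<longrightarrow> x \<in> U \<longrightarrow> variation X \<mu> U > 0}"

text \<open>
  The positive part of the Jordan decomposition, $\mu^+(E) = \sup \{\mu(B) : B \subseteq E\}$.
  The truncation of negative reals by \<^const>\<open>ennreal\<close> is harmless, since $B = \emptyset$
  contributes 0. The negative part $\mu^-$ is the positive part of $-\mu$.
\<close>

definition positive_part :: "'a topology \<Rightarrow> ('a set \<Rightarrow> real) \<Rightarrow> 'a measure" where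
  "positive_part X \<mu> = measure_of (topspace X) (sets (borel_of X))
     (\<lambda>E. SUP B \<in> {B \<in> sets (borel_of X). B \<subseteq> E}. ennreal (\<mu> B))"

definition negative_part :: "'a topology \<Rightarrow> ('a set \<Rightarrow> real) \<Rightarrow> 'a measure" where
  "negative_part X \<mu> = positive_part X (\<lambda>E. - \<mu> E)"

definition signed_integrable :: "'a topology \<Rightarrow> ('a set \<Rightarrow> real) \<Rightarrow> ('a \<Rightarrow> real) \<Rightarrow> bool" where
  "signed_integrable X \<mu> f \<longleftrightarrow>
     integrable (positive_part X \<mu>) f \<and> integrable (negative_part X \<mu>) f"

definition signed_integral :: "'a topology \<Rightarrow> ('a set \<Rightarrow> real) \<Rightarrow> ('a \<Rightarrow> real) \<Rightarrow> real" where
  "signed_integral X \<mu> f =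
     (LINT x|positive_part X \<mu>. f x) - (LINT x|negative_part X \<mu>. f x)"

text \<open>
  Continuous functions need not be bounded, so integrability is required explicitly: the library
  integral of a non-integrable function is 0.
\<close>

definition JN_sequence :: "'a topology \<Rightarrow> (nat \<Rightarrow> 'a set \<Rightarrow> real) \<Rightarrow> bool" where
  "JN_sequence X \<mu> \<longleftrightarrow>
     (\<forall>n. signed_radon_measure X (\<mu> n) \<and> variation_norm X (\<mu> n) = 1) \<and>
     (\<forall>f. continuous_map X euclideanreal f \<longrightarrow>
        (\<forall>n. signed_integrable X (\<mu> n) f) \<and>
        (\<lambda>n. signed_integral X (\<mu> n) f) \<longlonglongrightarrow> 0)"

definition fsJN_sequence :: "'a topology \<Rightarrow> (nat \<Rightarrow> 'a set \<Rightarrow> real) \<Rightarrow> bool" where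
  "fsJN_sequence X \<mu> \<longleftrightarrow> JN_sequence X \<mu> \<and> (\<forall>n. finite (supp X (\<mu> n)))"

definition fsJNP :: "'a topology \<Rightarrow> bool" where
  "fsJNP X \<longleftrightarrow> (\<exists>\<mu>. fsJN_sequence X \<mu>)"

end

theory Submission imports Defs begin

text \<open>
  On a Hausdorff space a signed Radon measure of finite support is a combination
  $\sum_x a(x)\,\delta_x$ of point masses at its support (\<open>finite_supp_imp_atomic\<close>), with norm
  $\sum_x |a(x)|$ and integral $\sum_x a(x) f(x)$. So the theorem is one about sequences of finitely
  supported coefficient functions $a_n$ of $\ell_1$-norm 1 whose pairings with every continuous
  function tend to 0.

  If the mass of $a_n$ on every finite set tended to 0, the classical gliding hump would do: pass to
  a subsequence whose terms are almost carried by sets disjoint from the supports of the earlier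
  terms, and cut off the small overlaps. In general the $a_n$ may settle on nonzero coefficients at
  some points, and then one uses differences $a_m - a_r$. On a given finite set these can be made as
  small as desired, since there the $a_n$ form a bounded sequence in a finite-dimensional space.
  They could be useless only if their total norm were small, that is, if $(a_n)$ had a subsequence
  convergent in $\ell_1$; but a nonzero limit would be a nonzero measure annihilating all bounded
  continuous functions, which complete regularity forbids. The quantitative form of this is
  \<open>no_concentration_on_finite_sets\<close>: some fixed amount of mass escapes, infinitely often, from
  every finite set. It yields \<open>differences_leave_finite_sets\<close>.

  Cutting off the overlap with earlier supports changes the pairing with \<open>f\<close> by at most the
  discarded mass times the supremum of $|f|$ over the supports. Continuous functions need not be
  bounded, so one has to know that each of them is bounded on the union of all supports. This is
  \<open>continuous_bounded_on_atoms\<close>: from a function unbounded there, a locally finite sum of bumps is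
  built on which the $a_n$ do not tend to 0.
\<close>

section \<open>Atomic measures\<close>

text \<open>
  A finitely supported measure $\sum_x a(x)\,\delta_x$ is represented by its coefficient function
  \<open>a\<close>. The definitions below are its support, the measure itself, its variation and its integral.
\<close>

definition atoms :: "('a \<Rightarrow> real) \<Rightarrow> 'a set" where
  "atoms a = {x. a x \<noteq> 0}"

definition atomic_measure :: "('a \<Rightarrow> real) \<Rightarrow> 'a set \<Rightarrow> real" where
  "atomic_measure a E = (\<Sum>x\<in>atoms a \<inter> E. a x)"

definition mass :: "('a \<Rightarrow> real) \<Rightarrow> 'a set \<Rightarrow> real" where
  "mass a E = (\<Sum>x\<in>atoms a \<inter> E. \<bar>a x\<bar>)"

definition pairing :: "('a \<Rightarrow> real) \<Rightarrow> ('a \<Rightarrow> real) \<Rightarrow> real" where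
  "pairing a f = (\<Sum>x\<in>atoms a. a x * f x)"

lemma atomic_measure_superset:
  assumes "finite F" "atoms a \<inter> E \<subseteq> F" "F \<subseteq> E"
  shows "atomic_measure a E = (\<Sum>x\<in>F. a x)"
  unfolding atomic_measure_def using assms by (intro sum.mono_neutral_left) (auto simp: atoms_def)

lemma mass_superset:
  assumes "finite F" "atoms a \<inter> E \<subseteq> F" "F \<subseteq> E"
  shows "mass a E = (\<Sum>x\<in>F. \<bar>a x\<bar>)"
  unfolding mass_def using assms by (intro sum.mono_neutral_left) (auto simp: atoms_def)

lemma pairing_superset:
  assumes "finite F" "atoms a \<subseteq> F"
  shows "pairing a f = (\<Sum>x\<in>F. a x * f x)"
  unfolding pairing_def using assms by (intro sum.mono_neutral_left) (auto simp: atoms_def)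

section \<open>Borel sets of a topological space\<close>

lemma space_borel_of [simp]: "space (borel_of X) = topspace X"
  by (simp add: borel_of_def space_measure_of_conv)

lemma sets_borel_of: "sets (borel_of X) = sigma_sets (topspace X) {U. openin X U}"
  unfolding borel_of_def by (rule sets_measure_of) (auto dest: openin_subset)

lemma borel_of_openin: "openin X U \<Longrightarrow> U \<in> sets (borel_of X)"
  by (simp add: sets_borel_of sigma_sets.Basic)

lemma borel_of_closedin: "closedin X C \<Longrightarrow> C \<in> sets (borel_of X)"
proof -
  assume C: "closedin X C"
  then have "topspace X - C \<in> sets (borel_of X)"
    by (intro borel_of_openin) blast
  then have "space (borel_of X) - (topspace X - C) \<in> sets (borel_of X)"
    by blast
  then show ?thesis
    using closedin_subset[OF C] by (simp add: double_diff)
qed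

lemma borel_of_finite:
  "Hausdorff_space X \<Longrightarrow> finite F \<Longrightarrow> F \<subseteq> topspace X \<Longrightarrow> F \<in> sets (borel_of X)"
  by (simp add: borel_of_closedin closedin_Hausdorff_finite)

lemma continuous_map_borel_of_measurable:
  assumes "continuous_map X euclideanreal f"
  shows "f \<in> borel_measurable (borel_of X)"
proof (rule borel_measurableI)
  fix S :: "real set" assume "open S"
  then show "f -` S \<inter> space (borel_of X) \<in> sets (borel_of X)"
    using openin_continuous_map_preimage[OF assms, of S]
    by (intro borel_of_openin) (simp add: Collect_conj_eq Int_commute vimage_def)
qed

section \<open>Signed Radon measures of finite support are atomic\<close>

lemma signed_measure_Un:
  assumes "signed_measure X \<mu>" "A \<in> sets (borel_of X)" "B \<in> sets (borel_of X)" "A \<inter> B = {}"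
  shows "\<mu> (A \<union> B) = \<mu> A + \<mu> B"
proof -
  have "disjoint_family (binaryset A B)"
    using assms(4) by (auto simp: disjoint_family_on_def binaryset_def)
  moreover have "range (binaryset A B) \<subseteq> sets (borel_of X)"
    using assms(2,3) by (simp add: range_binaryset_eq)
  ultimately have "(\<lambda>i. \<mu> (binaryset A B i)) sums \<mu> (\<Union>i. binaryset A B i)"
    using assms(1) unfolding signed_measure_def by blast
  moreover have "(\<lambda>i. \<mu> (binaryset A B i)) sums (\<mu> A + \<mu> B)"
    using assms by (intro binaryset_sums) (simp add: signed_measure_def)
  ultimately show ?thesis
    using sums_unique2 by (metis UN_binaryset_eq)
qed

lemma variation_upper:
  assumes "A \<in> sets (borel_of X)" "A \<subseteq> E" "\<mu> {} = 0"
  shows "ennreal \<bar>\<mu> A\<bar> \<le> variation X \<mu> E"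
  unfolding variation_def
  by (rule SUP_upper2[where i="(A, {})"]) (use assms in auto)

lemma variation_zero_iff:
  assumes "\<mu> {} = 0"
  shows "variation X \<mu> E = 0 \<longleftrightarrow> (\<forall>A\<in>sets (borel_of X). A \<subseteq> E \<longrightarrow> \<mu> A = 0)"
proof
  assume "variation X \<mu> E = 0"
  then show "\<forall>A\<in>sets (borel_of X). A \<subseteq> E \<longrightarrow> \<mu> A = 0"
    using variation_upper[of _ X E \<mu>] assms by fastforce
next
  assume *: "\<forall>A\<in>sets (borel_of X). A \<subseteq> E \<longrightarrow> \<mu> A = 0"
  show "variation X \<mu> E = 0"
    unfolding variation_def using * by (auto simp: SUP_eq_iff simp flip: bot_ennreal)
qed

text \<open>
  A finite union of null open sets can be made disjoint one set at a time, so it is null as well;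
  for an infinite union this may fail, which is why compactness enters below.
\<close>

lemma null_finite_Union:
  assumes \<mu>: "signed_measure X \<mu>" and "finite \<F>"
    and "\<And>U. U \<in> \<F> \<Longrightarrow> openin X U \<and> variation X \<mu> U = 0"
    and "A \<in> sets (borel_of X)" "A \<subseteq> \<Union>\<F>"
  shows "\<mu> A = 0"
  using assms(2-)
proof (induction \<F> arbitrary: A rule: finite_induct)
  case empty
  then show ?case using \<mu> by (simp add: signed_measure_def)
next
  case (insert U \<F>)
  have U: "U \<in> sets (borel_of X)"
    using insert.prems by (simp add: borel_of_openin)
  have "\<mu> A = \<mu> ((A \<inter> U) \<union> (A - U))"
    by (simp add: Int_Diff_Un)
  also have "\<dots> = \<mu> (A \<inter> U) + \<mu> (A - U)"
    using U insert.prems by (intro signed_measure_Un[OF \<mu>]) auto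
  also have "\<mu> (A \<inter> U) = 0"
    using insert.prems(1)[of U] U insert.prems(2) \<mu> variation_zero_iff[of \<mu> X U]
    by (auto simp: signed_measure_def)
  also have "\<mu> (A - U) = 0"
    using U insert.prems by (intro insert.IH) auto
  finally show ?case by simp
qed

text \<open>
  By the Radon property all but an arbitrarily small part of the variation on \<open>E\<close> lives on a
  compact \<open>K \<subseteq> E\<close>, and a compact set disjoint from the support is covered by finitely many
  null open sets.
\<close>

lemma null_off_supp:
  assumes X: "Hausdorff_space X" and \<mu>: "signed_radon_measure X \<mu>"
    and E: "E \<in> sets (borel_of X)" "E \<inter> supp X \<mu> = {}"
  shows "\<mu> E = 0"
proof (rule ccontr)
  assume neq: "\<mu> E \<noteq> 0"
  have sm: "signed_measure X \<mu>" and z: "\<mu> {} = 0"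
    using \<mu> by (auto simp: signed_radon_measure_def signed_measure_def)
  obtain K where K: "compactin X K" "K \<subseteq> E" "variation X \<mu> (E - K) < ennreal \<bar>\<mu> E\<bar>"
    using \<mu> E(1) neq unfolding signed_radon_measure_def
    by (metis zero_less_abs_iff)
  have KB: "K \<in> sets (borel_of X)"
    using X K(1) by (simp add: borel_of_closedin compactin_imp_closedin)
  let ?\<U> = "{U. openin X U \<and> variation X \<mu> U = 0}"
  have "K \<subseteq> \<Union>?\<U>"
  proof
    fix x assume "x \<in> K"
    then have "x \<in> topspace X" "x \<notin> supp X \<mu>"
      using K E compactin_subset_topspace by fastforce+
    then show "x \<in> \<Union>?\<U>"
      by (auto simp: supp_def zero_less_iff_neq_zero)
  qed
  then obtain \<F> where "finite \<F>" "\<F> \<subseteq> ?\<U>" "K \<subseteq> \<Union>\<F>"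
    using K(1) unfolding compactin_def by (metis (no_types, lifting) mem_Collect_eq)
  then have "\<mu> K = 0"
    using KB by (intro null_finite_Union[OF sm, of \<F>]) auto
  moreover have "\<mu> (K \<union> (E - K)) = \<mu> K + \<mu> (E - K)"
    using KB E by (intro signed_measure_Un[OF sm]) auto
  moreover have "K \<union> (E - K) = E"
    using K(2) by blast
  ultimately have "\<mu> E = \<mu> (E - K)"
    by simp
  moreover have "ennreal \<bar>\<mu> (E - K)\<bar> \<le> variation X \<mu> (E - K)"
    using KB E z by (intro variation_upper) auto
  ultimately show False
    using K(3) by simp
qed

lemma finite_supp_imp_atomic:
  assumes X: "Hausdorff_space X" and \<mu>: "signed_radon_measure X \<mu>"
    and fin: "finite (supp X \<mu>)"
  defines "a \<equiv> \<lambda>x. if x \<in> supp X \<mu> then \<mu> {x} else 0"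
  assumes E: "E \<in> sets (borel_of X)"
  shows "\<mu> E = atomic_measure a E"
proof -
  have sm: "signed_measure X \<mu>" and z: "\<mu> {} = 0"
    using \<mu> by (auto simp: signed_radon_measure_def signed_measure_def)
  have top: "supp X \<mu> \<subseteq> topspace X"
    by (auto simp: supp_def)
  have fs: "\<mu> F = (\<Sum>x\<in>F. a x)" if "finite F" "F \<subseteq> supp X \<mu>" for F
    using that
  proof (induction F rule: finite_induct)
    case (insert x F)
    have "\<mu> ({x} \<union> F) = \<mu> {x} + \<mu> F"
      using insert top by (intro signed_measure_Un[OF sm] borel_of_finite X) auto
    then show ?case
      using insert by (simp add: a_def)
  qed (simp add: z)
  let ?F = "supp X \<mu> \<inter> E"
  have F: "?F \<in> sets (borel_of X)"
    using fin top by (intro borel_of_finite X) auto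
  have "\<mu> E = \<mu> (?F \<union> (E - ?F))"
    by (simp add: Un_absorb1)
  also have "\<dots> = \<mu> ?F + \<mu> (E - ?F)"
    using F E by (intro signed_measure_Un[OF sm]) auto
  also have "\<mu> (E - ?F) = 0"
    using F E by (intro null_off_supp[OF X \<mu>]) auto
  also have "\<mu> ?F = atomic_measure a E"
    using fin
    by (subst fs, simp, simp)
       (rule atomic_measure_superset[symmetric], auto simp: a_def atoms_def split: if_splits)
  finally show ?thesis by simp
qed

lemma variation_cong:
  assumes "\<And>E. E \<in> sets (borel_of X) \<Longrightarrow> \<mu> E = \<nu> E"
  shows "variation X \<mu> E = variation X \<nu> E"
  unfolding variation_def using assms by (intro SUP_cong) auto

lemma positive_part_cong:
  assumes "\<And>E. E \<in> sets (borel_of X) \<Longrightarrow> \<mu> E = \<nu> E"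
  shows "positive_part X \<mu> = positive_part X \<nu>"
proof -
  have "(\<lambda>E. SUP B \<in> {B \<in> sets (borel_of X). B \<subseteq> E}. ennreal (\<mu> B)) =
        (\<lambda>E. SUP B \<in> {B \<in> sets (borel_of X). B \<subseteq> E}. ennreal (\<nu> B))"
    using assms by (intro ext SUP_cong) auto
  then show ?thesis
    by (simp add: positive_part_def)
qed

lemma signed_integral_cong:
  assumes "\<And>E. E \<in> sets (borel_of X) \<Longrightarrow> \<mu> E = \<nu> E"
  shows "signed_integral X \<mu> f = signed_integral X \<nu> f"
  using positive_part_cong[of X \<mu> \<nu>] positive_part_cong[of X "\<lambda>E. - \<mu> E" "\<lambda>E. - \<nu> E"] assms
  by (simp add: signed_integral_def negative_part_def)

section \<open>Variation, support and integral of an atomic measure\<close>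

context
  fixes X :: "'a topology" and a :: "'a \<Rightarrow> real"
  assumes X: "Hausdorff_space X" and fin: "finite (atoms a)" and top: "atoms a \<subseteq> topspace X"
begin

lemma atoms_borel: "F \<subseteq> atoms a \<Longrightarrow> F \<in> sets (borel_of X)"
  using fin top by (intro borel_of_finite X) (auto dest: finite_subset)

lemma atomic_signed_measure: "signed_measure X (atomic_measure a)"
  unfolding signed_measure_def
proof (intro conjI allI impI)
  have eq: "atomic_measure a E = (\<Sum>x\<in>atoms a. a x * indicator E x)" for E
    unfolding atomic_measure_def using fin by (simp add: indicator_def sum.If_cases)
  fix A :: "nat \<Rightarrow> 'a set" assume "disjoint_family A"
  then show "(\<lambda>i. atomic_measure a (A i)) sums atomic_measure a (\<Union>i. A i)"
    unfolding eq
    by (intro sums_sum sums_mult indicator_sums) (auto simp: disjoint_family_on_def)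
qed (simp add: atomic_measure_def)

text \<open>
  The supremum is attained at the pair formed by the positive and the negative atoms in \<open>E\<close>; since
  both sets are finite they are Borel even if \<open>E\<close> is not.
\<close>

lemma atomic_variation: "variation X (atomic_measure a) E = ennreal (mass a E)"
  unfolding variation_def
proof (rule antisym)
  show "(SUP (A, B) \<in> {(A, B). A \<in> sets (borel_of X) \<and> B \<in> sets (borel_of X) \<and>
            A \<subseteq> E \<and> B \<subseteq> E \<and> A \<inter> B = {}}.
        ennreal (\<bar>atomic_measure a A\<bar> + \<bar>atomic_measure a B\<bar>)) \<le> ennreal (mass a E)"
  proof (rule SUP_least, clarify, rule ennreal_leI)
    fix A B assume AB: "A \<subseteq> E" "B \<subseteq> E" "A \<inter> B = {}"
    have "\<bar>atomic_measure a A\<bar> + \<bar>atomic_measure a B\<bar> \<le> mass a A + mass a B"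
      unfolding atomic_measure_def mass_def by (intro add_mono sum_abs)
    also have "\<dots> = (\<Sum>x\<in>atoms a \<inter> (A \<union> B). \<bar>a x\<bar>)"
      unfolding mass_def Int_Un_distrib using fin AB by (intro sum.union_disjoint[symmetric]) auto
    also have "\<dots> \<le> mass a E"
      unfolding mass_def using fin AB by (intro sum_mono2) auto
    finally show "\<bar>atomic_measure a A\<bar> + \<bar>atomic_measure a B\<bar> \<le> mass a E" .
  qed
next
  define A B where "A = {x\<in>atoms a \<inter> E. a x > 0}" and "B = {x\<in>atoms a \<inter> E. a x < 0}"
  have AB: "A \<subseteq> atoms a" "B \<subseteq> atoms a" "A \<subseteq> E" "B \<subseteq> E" "A \<inter> B = {}"
    by (auto simp: A_def B_def)
  then have [simp]: "finite A" "finite B"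
    using fin by (auto dest: finite_subset)
  have "mass a E = (\<Sum>x\<in>A \<union> B. \<bar>a x\<bar>)"
    unfolding mass_def by (intro sum.cong) (auto simp: A_def B_def atoms_def)
  also have "\<dots> = (\<Sum>x\<in>A. \<bar>a x\<bar>) + (\<Sum>x\<in>B. \<bar>a x\<bar>)"
    using AB by (intro sum.union_disjoint) auto
  also have "(\<Sum>x\<in>A. \<bar>a x\<bar>) = atomic_measure a A"
    unfolding atomic_measure_def by (intro sum.cong) (auto simp: A_def)
  also have "(\<Sum>x\<in>B. \<bar>a x\<bar>) = - atomic_measure a B"
    unfolding atomic_measure_def sum_negf[symmetric] by (intro sum.cong) (auto simp: B_def)
  finally have "mass a E \<le> \<bar>atomic_measure a A\<bar> + \<bar>atomic_measure a B\<bar>"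
    by simp
  then show "ennreal (mass a E) \<le> (SUP (A, B) \<in> {(A, B). A \<in> sets (borel_of X) \<and>
        B \<in> sets (borel_of X) \<and> A \<subseteq> E \<and> B \<subseteq> E \<and> A \<inter> B = {}}.
        ennreal (\<bar>atomic_measure a A\<bar> + \<bar>atomic_measure a B\<bar>))"
    using AB by (intro SUP_upper2[where i="(A, B)"]) (auto intro: atoms_borel simp flip: ennreal_plus)
qed

text \<open>
  A point that is no atom has the complement of the finite, hence closed, set of atoms as a null
  neighbourhood.
\<close>

lemma atomic_supp: "supp X (atomic_measure a) = atoms a"
proof (intro set_eqI iffI)
  fix x assume x: "x \<in> supp X (atomic_measure a)"
  show "x \<in> atoms a"
  proof (rule ccontr)
    assume "x \<notin> atoms a"
    moreover have "openin X (topspace X - atoms a)"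
      using closedin_Hausdorff_finite[OF X top fin] by blast
    ultimately have "variation X (atomic_measure a) (topspace X - atoms a) > 0"
      using x by (auto simp: supp_def)
    moreover have "mass a (topspace X - atoms a) = 0"
      unfolding mass_def by (intro sum.neutral) auto
    ultimately show False
      by (simp add: atomic_variation)
  qed
next
  fix x assume x: "x \<in> atoms a"
  have "mass a U > 0" if "x \<in> U" for U
    unfolding mass_def using fin x that by (intro sum_pos) (auto simp: atoms_def)
  then show "x \<in> supp X (atomic_measure a)"
    using x top by (auto simp: supp_def atomic_variation)
qed

lemma atomic_radon: "signed_radon_measure X (atomic_measure a)"
  unfolding signed_radon_measure_def
proof (intro conjI ballI allI impI)
  fix E and \<epsilon> :: real assume "\<epsilon> > 0"
  moreover have "mass a (E - atoms a \<inter> E) = 0"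
    unfolding mass_def by (intro sum.neutral) auto
  moreover have "compactin X (atoms a \<inter> E)"
    using fin top by (intro finite_imp_compactin) auto
  ultimately show "\<exists>K. compactin X K \<and> K \<subseteq> E \<and>
      variation X (atomic_measure a) (E - K) < ennreal \<epsilon>"
    by (intro exI[of _ "atoms a \<inter> E"]) (simp add: atomic_variation)
qed (rule atomic_signed_measure)

text \<open>
  The supremum defining the positive part is attained at the set of positive atoms. Presenting the
  result as an image of a point measure on the finite set of atoms gives its integrals for free.
\<close>

lemma atomic_positive_part:
  "positive_part X (atomic_measure a) =
   distr (point_measure (atoms a) (\<lambda>x. ennreal (max 0 (a x)))) (borel_of X) (\<lambda>x. x)"
    (is "_ = ?M")
proof -
  have "(SUP B \<in> {B \<in> sets (borel_of X). B \<subseteq> E}. ennreal (atomic_measure a B)) = emeasure ?M E"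
    if E: "E \<in> sets (borel_of X)" for E
  proof -
    have "emeasure ?M E = emeasure (point_measure (atoms a) (\<lambda>x. ennreal (max 0 (a x)))) (E \<inter> atoms a)"
      using E top by (subst emeasure_distr) (auto simp: space_point_measure)
    also have "\<dots> = ennreal (\<Sum>x\<in>E \<inter> atoms a. max 0 (a x))"
      using fin by (subst emeasure_point_measure_finite) auto
    also have "\<dots> = (SUP B \<in> {B \<in> sets (borel_of X). B \<subseteq> E}. ennreal (atomic_measure a B))"
    proof (rule antisym)
      let ?B = "{x \<in> E \<inter> atoms a. a x > 0}"
      have "(\<Sum>x\<in>E \<inter> atoms a. max 0 (a x)) = (\<Sum>x\<in>?B. a x)"
        using fin by (intro sum.mono_neutral_cong_right) auto
      also have "\<dots> = atomic_measure a ?B"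
        unfolding atomic_measure_def by (intro sum.cong) auto
      finally show "ennreal (\<Sum>x\<in>E \<inter> atoms a. max 0 (a x)) \<le>
          (SUP B \<in> {B \<in> sets (borel_of X). B \<subseteq> E}. ennreal (atomic_measure a B))"
        by (intro SUP_upper2[where i="?B"]) (auto intro: atoms_borel)
    next
      show "(SUP B \<in> {B \<in> sets (borel_of X). B \<subseteq> E}. ennreal (atomic_measure a B)) \<le>
          ennreal (\<Sum>x\<in>E \<inter> atoms a. max 0 (a x))"
      proof (rule SUP_least, clarify, rule ennreal_leI)
        fix B assume "B \<subseteq> E"
        then have "(\<Sum>x\<in>atoms a \<inter> B. max 0 (a x)) \<le> (\<Sum>x\<in>E \<inter> atoms a. max 0 (a x))"
          using fin by (intro sum_mono2) auto
        moreover have "atomic_measure a B \<le> (\<Sum>x\<in>atoms a \<inter> B. max 0 (a x))"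
          unfolding atomic_measure_def by (intro sum_mono) auto
        ultimately show "atomic_measure a B \<le> (\<Sum>x\<in>E \<inter> atoms a. max 0 (a x))"
          by linarith
      qed
    qed
    finally show ?thesis by simp
  qed
  then have "positive_part X (atomic_measure a) =
      measure_of (topspace X) (sets (borel_of X)) (emeasure ?M)"
    unfolding positive_part_def
    by (intro measure_of_eq)
       (use sets.space_closed[of "borel_of X"] sets.sigma_sets_eq[of "borel_of X"] in auto)
  also have "\<dots> = ?M"
    using measure_of_of_measure[of ?M] by simp
  finally show ?thesis .
qed

lemma atomic_positive_integral:
  assumes f: "continuous_map X euclideanreal f"
  shows "integrable (positive_part X (atomic_measure a)) f"
    and "(LINT x|positive_part X (atomic_measure a). f x) = (\<Sum>x\<in>atoms a. max 0 (a x) * f x)"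
proof -
  note [measurable] = continuous_map_borel_of_measurable[OF f]
  have [measurable]: "(\<lambda>x. x) \<in> measurable (point_measure (atoms a) (\<lambda>x. ennreal (max 0 (a x)))) (borel_of X)"
    using top by (auto simp: subset_iff)
  show "integrable (positive_part X (atomic_measure a)) f"
    unfolding atomic_positive_part using fin top
    by (subst integrable_distr_eq) (auto intro: integrable_point_measure_finite)
  show "(LINT x|positive_part X (atomic_measure a). f x) = (\<Sum>x\<in>atoms a. max 0 (a x) * f x)"
    unfolding atomic_positive_part using fin top
    by (subst integral_distr) (auto simp: lebesgue_integral_point_measure_finite)
qed

end

lemma atomic_signed_integral:
  assumes X: "Hausdorff_space X" and fin: "finite (atoms a)" and top: "atoms a \<subseteq> topspace X"
    and f: "continuous_map X euclideanreal f"
  shows "signed_integrable X (atomic_measure a) f"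
    and "signed_integral X (atomic_measure a) f = pairing a f"
proof -
  let ?b = "\<lambda>x. - a x"
  have at: "atoms ?b = atoms a"
    by (simp add: atoms_def)
  have neg: "negative_part X (atomic_measure a) = positive_part X (atomic_measure ?b)"
    by (simp add: negative_part_def atomic_measure_def[abs_def] at sum_negf)
  note pos = atomic_positive_integral[OF X fin top f]
  note npos = atomic_positive_integral[OF X, of ?b f, unfolded at, OF fin top f]
  show "signed_integrable X (atomic_measure a) f"
    using pos npos by (simp add: signed_integrable_def neg)
  have "max 0 (a x) * f x - max 0 (- a x) * f x = a x * f x" for x
    by (auto simp: max_def)
  then show "signed_integral X (atomic_measure a) f = pairing a f"
    by (simp add: signed_integral_def neg pos npos pairing_def flip: sum_subtractf)
qed

section \<open>Mass and pairing under differences\<close>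

lemma pairing_diff:
  assumes "finite (atoms a)" "finite (atoms b)"
  shows "pairing (\<lambda>x. a x - b x) f = pairing a f - pairing b f"
proof -
  have "pairing c f = (\<Sum>x\<in>atoms a \<union> atoms b. c x * f x)"
    if "c \<in> {\<lambda>x. a x - b x, a, b}" for c
    using assms that by (intro pairing_superset) (auto simp: atoms_def)
  then show ?thesis
    by (simp add: left_diff_distrib sum_subtractf)
qed

lemma atoms_diff: "atoms (\<lambda>x. a x - b x) \<subseteq> atoms a \<union> atoms b"
  by (auto simp: atoms_def)

lemma mass_mono: "finite (atoms a) \<Longrightarrow> E \<subseteq> F \<Longrightarrow> mass a E \<le> mass a F"
  unfolding mass_def by (intro sum_mono2) auto

lemma mass_compl:
  assumes "finite (atoms a)"
  shows "mass a UNIV = mass a F + mass a (- F)"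
proof -
  have "mass a UNIV = (\<Sum>x\<in>(atoms a \<inter> F) \<union> (atoms a \<inter> - F). \<bar>a x\<bar>)"
    unfolding mass_def by (intro sum.cong) auto
  also have "\<dots> = mass a F + mass a (- F)"
    unfolding mass_def using assms by (intro sum.union_disjoint) auto
  finally show ?thesis .
qed

lemma mass_cong:
  assumes "\<And>x. x \<in> E \<Longrightarrow> a x = b x"
  shows "mass a E = mass b E"
  unfolding mass_def using assms by (intro sum.cong) (auto simp: atoms_def)

lemma abs_le_mass:
  assumes "finite (atoms a)" "x \<in> E"
  shows "\<bar>a x\<bar> \<le> mass a E"
proof (cases "x \<in> atoms a")
  case True
  then show ?thesis
    unfolding mass_def using assms by (intro member_le_sum) auto
next
  case False
  then show ?thesis
    by (simp add: atoms_def mass_def sum_nonneg)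
qed

section \<open>Isolating points and solving triangular systems\<close>

lemma Tychonoff_isolate:
  assumes X: "Tychonoff_space X" and x: "x \<in> topspace X" and F: "finite F"
  obtains f where "continuous_map X euclideanreal f" "f x = 1"
    "\<And>y. y \<in> topspace X \<Longrightarrow> y \<in> F \<Longrightarrow> y \<noteq> x \<Longrightarrow> f y = 0"
    "\<And>y. y \<in> topspace X \<Longrightarrow> \<bar>f y\<bar> \<le> 1"
proof -
  let ?S = "F \<inter> topspace X - {x}"
  have "closedin X ?S"
    using X F by (intro closedin_Hausdorff_finite) (auto simp: Tychonoff_space_def)
  moreover have "x \<in> topspace X - ?S"
    using x by auto
  ultimately obtain g :: "_ \<Rightarrow> real" where g: "continuous_map X (top_of_set {0..1}) g" "g x = 0" "g ` ?S \<subseteq> {1}"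
    using X unfolding Tychonoff_space_def completely_regular_space_def by meson
  have gc: "continuous_map X euclideanreal g"
    using g(1) by (simp add: continuous_map_in_subtopology)
  have g01: "g y \<in> {0..1}" if "y \<in> topspace X" for y
    using g(1) that by (auto simp: continuous_map_in_subtopology)
  show ?thesis
  proof
    show "continuous_map X euclideanreal (\<lambda>y. 1 - g y)"
      using gc by (intro continuous_intros) auto
    show "\<bar>1 - g y\<bar> \<le> 1" if "y \<in> topspace X" for y
      using g01[OF that] by auto
  qed (use g in auto)
qed

text \<open>The equations are solved successively, the \<open>k\<close>-th one for \<open>c k\<close>.\<close>

lemma triangular_system_solvable:
  fixes T :: "nat \<Rightarrow> nat \<Rightarrow> real"
  assumes "\<And>k. T k k \<noteq> 0"
  shows "\<exists>c. \<forall>k. (\<Sum>j<Suc k. c j * T k j) = 1"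
proof -
  have "\<exists>c. \<forall>k. (\<Sum>j<k. c j * T k j) + c k * T k k = 1"
  proof (rule dependent_wellorder_choice)
    fix r and f g :: "nat \<Rightarrow> real" and k
    assume "\<And>y. y < k \<Longrightarrow> f y = g y"
    then show "((\<Sum>j<k. f j * T k j) + r * T k k = 1) = ((\<Sum>j<k. g j * T k j) + r * T k k = 1)"
      by simp
  next
    fix k and f :: "nat \<Rightarrow> real"
    show "\<exists>r. (\<Sum>j<k. f j * T k j) + r * T k k = 1"
      using assms[of k] by (intro exI[of _ "(1 - (\<Sum>j<k. f j * T k j)) / T k k"]) simp
  qed
  then show ?thesis
    by simp
qed

section \<open>Continuous functions are bounded on the atoms\<close>

text \<open>
  An fsJN-sequence in terms of the coefficient functions of its measures. That functions are
  paired with \<open>a n\<close> by a finite sum makes integrability of unbounded functions automatic.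
\<close>

locale atomic_JN =
  fixes X :: "'a topology" and a :: "nat \<Rightarrow> 'a \<Rightarrow> real"
  assumes Tychonoff: "Tychonoff_space X"
    and finite_atoms: "finite (atoms (a n))"
    and atoms_topspace: "atoms (a n) \<subseteq> topspace X"
    and mass_one: "mass (a n) UNIV = 1"
    and null: "continuous_map X euclideanreal f \<Longrightarrow> (\<lambda>n. pairing (a n) f) \<longlonglongrightarrow> 0"
begin

text \<open>
  Suppose \<open>f\<close> is unbounded on the atoms, and put $h = |f|$. Then there are atoms $z_k$ of
  $a_{n_k}$ such that $h(z_k)$ exceeds by at least 2 every value of $h$ on the atoms of the measures
  up to index $n_{k-1}$. Let $u_k$ be the product of a bump in the value of $h$ around $h(z_k)$ and
  a function that separates $z_k$ from the other atoms of $a_{n_k}$; the second factor is needed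
  because $h$ may take the same value at several atoms, whose contributions could cancel. The
  supports of the $u_k$ are locally finite, so $g = \sum_j c_j u_j$ is continuous for every choice of
  the $c_j$. As $u_j$ vanishes on the atoms of $a_{n_k}$ for $j > k$, the values of $a_{n_k}$ at \<open>g\<close>
  form a triangular system in the $c_j$ with nonzero diagonal $a_{n_k}(z_k)$, and it can be solved
  so that all these values are 1. This contradicts that the values at \<open>g\<close> tend to 0.
\<close>

lemma continuous_bounded_on_atoms:
  assumes f: "continuous_map X euclideanreal f"
  obtains M where "\<And>n x. x \<in> atoms (a n) \<Longrightarrow> \<bar>f x\<bar> \<le> M"
proof (rule ccontr)
  assume "\<not> thesis"
  then have unbdd: "\<exists>n x. x \<in> atoms (a n) \<and> M < \<bar>f x\<bar>" for M
    using that not_le by blast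
  define h where "h = (\<lambda>x. \<bar>f x\<bar>)"
  have h: "continuous_map X euclideanreal h"
    unfolding h_def using f by (intro continuous_intros)
  have "\<exists>q. \<forall>k. (snd (q k) \<in> atoms (a (fst (q k)))) \<and>
      (\<forall>i\<le>fst (q k). \<forall>y\<in>atoms (a i). h y + 2 \<le> h (snd (q (Suc k))))"
  proof (rule dependent_nat_choice)
    show "\<exists>p. snd p \<in> atoms (a (fst p))"
      using unbdd[of 0] by auto
  next
    fix p :: "nat \<times> 'a" and k :: nat
    define S where "S = (\<Union>i\<le>fst p. atoms (a i))"
    have S: "finite S"
      by (simp add: S_def finite_atoms)
    obtain n x where nx: "x \<in> atoms (a n)" "sum h S + 2 < h x"
      using unbdd[of "sum h S + 2"] unfolding h_def by blast
    have "h y \<le> sum h S" if "y \<in> S" for y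
      using S that by (intro member_le_sum) (auto simp: h_def)
    then show "\<exists>q. snd q \<in> atoms (a (fst q)) \<and> (\<forall>i\<le>fst p. \<forall>y\<in>atoms (a i). h y + 2 \<le> h (snd q))"
      using nx by (intro exI[of _ "(n, x)"]) (fastforce simp: S_def)
  qed
  then obtain q where q: "\<And>k. snd (q k) \<in> atoms (a (fst (q k)))"
      "\<And>k i y. i \<le> fst (q k) \<Longrightarrow> y \<in> atoms (a i) \<Longrightarrow> h y + 2 \<le> h (snd (q (Suc k)))"
    by blast
  define n z where "n = fst \<circ> q" and "z = snd \<circ> q"
  have z: "z k \<in> atoms (a (n k))" for k
    using q(1) by (simp add: n_def z_def)
  have step: "h y + 2 \<le> h (z (Suc k))" if "i \<le> n k" "y \<in> atoms (a i)" for i k y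
    using q(2) that by (simp add: n_def z_def)
  have "n k < n (Suc k)" for k
    using step[of "n (Suc k)" k "z (Suc k)"] z[of "Suc k"] by (cases "n k < n (Suc k)") auto
  then have n: "strict_mono n"
    by (simp add: strict_mono_Suc_iff)
  have later: "h y + 2 \<le> h (z j)" if y: "y \<in> atoms (a (n k))" and "k < j" for y k j
  proof -
    obtain i where "j = Suc i" "k \<le> i"
      using \<open>k < j\<close> by (cases j) auto
    then show ?thesis
      using step[of "n k" i y] y n by (simp add: strict_mono_less_eq)
  qed
  have grow: "2 * real k \<le> h (z k)" for k
  proof (induction k)
    case (Suc k)
    then show ?case
      using later[OF z, of k "Suc k"] by simp
  qed (simp add: h_def)
  have "\<exists>e. continuous_map X euclideanreal e \<and> e (z k) = 1 \<and>
      (\<forall>y\<in>atoms (a (n k)). y \<noteq> z k \<longrightarrow> e y = 0)" for k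
    using Tychonoff_isolate[OF Tychonoff, of "z k" "atoms (a (n k))"] z[of k] atoms_topspace[of "n k"]
      finite_atoms[of "n k"] by (metis subsetD)
  then obtain e where e: "\<And>k. continuous_map X euclideanreal (e k)" "\<And>k. e k (z k) = 1"
      "\<And>k y. y \<in> atoms (a (n k)) \<Longrightarrow> y \<noteq> z k \<Longrightarrow> e k y = 0"
    by metis
  \<comment> \<open>The first factor makes the bumps locally finite, the second isolates the atom \<open>z k\<close>.\<close>
  define u where "u = (\<lambda>k x. max 0 (1 - \<bar>h x - h (z k)\<bar>) * e k x)"
  have u: "continuous_map X euclideanreal (u k)" for k
    unfolding u_def using h e(1)[of k] by (intro continuous_intros) auto
  have u_later: "u j y = 0" if "y \<in> atoms (a (n k))" "k < j" for y k j
    using later[OF that] by (simp add: u_def)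
  have u_far: "u k x = 0" if "h x + 1 \<le> real k" for k x
    using grow[of k] that by (simp add: u_def)
  define T where "T = (\<lambda>k j. pairing (a (n k)) (u j))"
  have "T k k = a (n k) (z k)" for k
  proof -
    have "T k k = (\<Sum>x\<in>atoms (a (n k)). if x = z k then a (n k) x else 0)"
      unfolding T_def pairing_def using e(2)[of k] e(3)[of _ k] by (intro sum.cong) (auto simp: u_def)
    then show ?thesis
      using z[of k] finite_atoms[of "n k"] by simp
  qed
  then have "T k k \<noteq> 0" for k
    using z[of k] by (simp add: atoms_def)
  then obtain c where c: "\<And>k. (\<Sum>j<Suc k. c j * T k j) = 1"
    using triangular_system_solvable[of T] by blast
  define g where "g = (\<lambda>x. \<Sum>j. c j * u j x)"
  have g: "continuous_map X euclideanreal g"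
    \<comment> \<open>On the open set \<open>{h < N - 1}\<close> only the bumps of index below \<open>N\<close> are nonzero.\<close>
  proof (rule pasting_lemma)
    fix N :: nat
    show "openin X {x \<in> topspace X. h x \<in> {..<real N - 1}}"
      using h by (rule openin_continuous_map_preimage) simp
    show "continuous_map (subtopology X {x \<in> topspace X. h x \<in> {..<real N - 1}}) euclideanreal
        (\<lambda>x. \<Sum>j<N. c j * u j x)"
      by (intro continuous_map_from_subtopology continuous_intros u) auto
  next
    fix x
    have g_eq: "g x = (\<Sum>j<N. c j * u j x)" if "h x < real N - 1" for N
      unfolding g_def using that by (intro suminf_finite) (auto intro!: u_far)
    show "(\<Sum>j<M. c j * u j x) = (\<Sum>j<N. c j * u j x)"
      if "x \<in> topspace X \<inter> {x \<in> topspace X. h x \<in> {..<real M - 1}}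
            \<inter> {x \<in> topspace X. h x \<in> {..<real N - 1}}" for M N
      using g_eq[of M] g_eq[of N] that by simp
    show "\<exists>N. N \<in> UNIV \<and> x \<in> {x \<in> topspace X. h x \<in> {..<real N - 1}} \<and>
        g x = (\<Sum>j<N. c j * u j x)" if "x \<in> topspace X"
    proof -
      obtain N where "h x + 1 < real N"
        using reals_Archimedean2 by blast
      then show ?thesis
        using that g_eq[of N] by (intro exI[of _ N]) auto
    qed
  qed
  have "pairing (a (n k)) g = 1" for k
  proof -
    have "pairing (a (n k)) g = (\<Sum>x\<in>atoms (a (n k)). a (n k) x * (\<Sum>j<Suc k. c j * u j x))"
      unfolding pairing_def
    proof (rule sum.cong)
      fix x assume "x \<in> atoms (a (n k))"
      then have "g x = (\<Sum>j<Suc k. c j * u j x)"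
        unfolding g_def by (intro suminf_finite) (auto simp: u_later)
      then show "a (n k) x * g x = a (n k) x * (\<Sum>j<Suc k. c j * u j x)"
        by simp
    qed simp
    also have "\<dots> = (\<Sum>j<Suc k. c j * T k j)"
      unfolding T_def pairing_def sum_distrib_left
      by (subst sum.swap) (simp add: mult.left_commute del: sum.lessThan_Suc)
    also have "\<dots> = 1"
      by (rule c)
    finally show ?thesis .
  qed
  then show False
    using LIMSEQ_subseq_LIMSEQ[OF null[OF g] n] by (simp add: o_def LIMSEQ_const_iff)
qed

section \<open>Mass escapes from finite sets\<close>

text \<open>
  Otherwise, up to arbitrarily small mass, all \<open>a n\<close> from some index on live on a finite set. By the
  pigeonhole principle one point \<open>x\<close> of such a set then has a coefficient of modulus at least
  \<open>c > 0\<close> for infinitely many \<open>n\<close>. Take a finite set off which the mass is eventually below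
  \<open>c/2\<close>, and a continuous \<open>f\<close> with values in \<open>[-1, 1]\<close> that is 1 at \<open>x\<close> and 0 at the other points
  of this set. The pairings with \<open>f\<close> then have modulus above \<open>c/2\<close> infinitely often.
\<close>

lemma no_concentration_on_finite_sets:
  "\<exists>\<epsilon>>0. \<forall>F N. finite F \<longrightarrow> (\<exists>n\<ge>N. \<epsilon> \<le> mass (a n) (- F))"
proof (rule ccontr)
  assume "\<not> ?thesis"
  then have "\<exists>F N. finite F \<and> (\<forall>n\<ge>N. mass (a n) (- F) < \<epsilon>)" if "\<epsilon> > 0" for \<epsilon>
    using that by (meson not_le)
  then have conc: "\<exists>F. finite F \<and> (\<forall>\<^sub>F n in sequentially. mass (a n) (- F) < \<epsilon>)" if "\<epsilon> > 0" for \<epsilon>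
    using that unfolding eventually_sequentially by meson
  obtain F where F: "finite F" "\<forall>\<^sub>F n in sequentially. mass (a n) (- F) < 1/2"
    using conc[of "1/2"] by auto
  \<comment> \<open>The summand 1 keeps \<open>c\<close> meaningful for empty \<open>F\<close>; what matters is \<open>card F * c < 1/2\<close>.\<close>
  define c where "c = 1 / (2 * (real (card F) + 1))"
  have "c > 0"
    by (simp add: c_def)
  have "\<exists>x\<in>F. \<exists>\<^sub>F n in sequentially. c \<le> \<bar>a n x\<bar>"
  proof (rule ccontr)
    assume "\<not> ?thesis"
    then have "\<forall>x\<in>F. \<forall>\<^sub>F n in sequentially. \<bar>a n x\<bar> < c"
      by (simp add: not_frequently not_le)
    then have "\<forall>\<^sub>F n in sequentially. \<forall>x\<in>F. \<bar>a n x\<bar> < c"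
      using F(1) by (simp add: eventually_ball_finite_distrib)
    then have "\<forall>\<^sub>F n in sequentially. (\<forall>x\<in>F. \<bar>a n x\<bar> < c) \<and> mass (a n) (- F) < 1/2"
      using F(2) by (rule eventually_conj)
    then obtain n where n: "\<forall>x\<in>F. \<bar>a n x\<bar> < c" "mass (a n) (- F) < 1/2"
      using eventually_happens' sequentially_bot by blast
    have "mass (a n) F = (\<Sum>x\<in>F. \<bar>a n x\<bar>)"
      using F by (intro mass_superset) auto
    also have "\<dots> \<le> real (card F) * c"
      using n(1) by (intro sum_bounded_above) auto
    also have "\<dots> < 1/2"
      by (simp add: c_def field_simps)
    finally show False
      using n(2) mass_compl[OF finite_atoms, of n F] mass_one[of n] by simp
  qed
  then obtain x where x: "\<exists>\<^sub>F n in sequentially. c \<le> \<bar>a n x\<bar>"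
    by blast
  then obtain k where "c \<le> \<bar>a k x\<bar>"
    using frequently_ex by blast
  then have xX: "x \<in> topspace X"
    using \<open>c > 0\<close> atoms_topspace[of k] by (auto simp: atoms_def)
  obtain F' where F': "finite F'" "\<forall>\<^sub>F n in sequentially. mass (a n) (- F') < c/2"
    using conc[of "c/2"] \<open>c > 0\<close> by auto
  obtain f where f: "continuous_map X euclideanreal f" "f x = 1"
    "\<And>y. y \<in> topspace X \<Longrightarrow> y \<in> F' \<Longrightarrow> y \<noteq> x \<Longrightarrow> f y = 0"
    "\<And>y. y \<in> topspace X \<Longrightarrow> \<bar>f y\<bar> \<le> 1"
    using Tychonoff_isolate[OF Tychonoff xX F'(1)] by blast
  have "\<forall>\<^sub>F n in sequentially. \<bar>pairing (a n) f\<bar> < c/2"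
    using tendstoD[OF null[OF f(1)], of "c/2"] \<open>c > 0\<close> by simp
  then have "\<forall>\<^sub>F n in sequentially. mass (a n) (- F') < c/2 \<and> \<bar>pairing (a n) f\<bar> < c/2"
    using F'(2) by (rule eventually_conj[rotated])
  then obtain n where n: "c \<le> \<bar>a n x\<bar>" "mass (a n) (- F') < c/2" "\<bar>pairing (a n) f\<bar> < c/2"
    using frequently_ex[OF frequently_eventually_conj[OF x]] by blast
  let ?A = "atoms (a n)"
  have xA: "x \<in> ?A"
    using n(1) \<open>c > 0\<close> by (auto simp: atoms_def)
  have "pairing (a n) f = a n x + (\<Sum>y\<in>?A - {x}. a n y * f y)"
    unfolding pairing_def using xA finite_atoms f(2) by (subst sum.remove) auto
  moreover have "\<bar>\<Sum>y\<in>?A - {x}. a n y * f y\<bar> \<le> mass (a n) (- F')"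
  proof -
    have "(\<Sum>y\<in>?A - {x}. a n y * f y) = (\<Sum>y\<in>(?A - {x}) \<inter> - F'. a n y * f y)"
      using finite_atoms[of n] atoms_topspace[of n] f(3) by (intro sum.mono_neutral_right) auto
    also have "\<bar>\<dots>\<bar> \<le> (\<Sum>y\<in>(?A - {x}) \<inter> - F'. \<bar>a n y\<bar>)"
      using atoms_topspace[of n] f(4)
      by (intro order_trans[OF sum_abs] sum_mono) (auto simp: abs_mult intro!: mult_left_le)
    also have "\<dots> \<le> mass (a n) (- F')"
      unfolding mass_def using finite_atoms[of n] by (intro sum_mono2) auto
    finally show ?thesis .
  qed
  ultimately show False
    using n by linarith
qed

text \<open>
  The restrictions of the \<open>a m\<close> to \<open>F\<close> lie in the cube $[-1,1]^F$, which is totally bounded: it is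
  cut into finitely many cells by rounding the coefficients to multiples of \<open>1 / K\<close>, and \<open>R\<close> picks
  one index from each cell that is met.
\<close>

lemma finite_net:
  assumes F: "finite F" and "\<delta> > 0"
  obtains R where "finite R" "R \<subseteq> {N..}"
    "\<And>m. m \<ge> N \<Longrightarrow> \<exists>r\<in>R. mass (\<lambda>x. a m x - a r x) F < \<delta>"
proof -
  obtain K :: nat where K: "real (card F) / \<delta> < real K"
    using reals_Archimedean2 by blast
  moreover have "0 \<le> real (card F) / \<delta>"
    using \<open>\<delta> > 0\<close> by simp
  ultimately have K0: "real K > 0"
    by linarith
  define cell where "cell = (\<lambda>m. restrict (\<lambda>x. \<lfloor>a m x * real K\<rfloor>) F)"
  have "cell m \<in> PiE F (\<lambda>_. {- int K..int K})" for m
  proof -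
    have "\<lfloor>a m x * real K\<rfloor> \<in> {- int K..int K}" for x
    proof -
      have "\<bar>a m x * real K\<bar> \<le> 1 * real K"
        unfolding abs_mult using abs_le_mass[OF finite_atoms, of x UNIV m] mass_one[of m]
        by (intro mult_mono) auto
      then have "- real K \<le> a m x * real K" "a m x * real K \<le> real K"
        by (auto simp: abs_le_iff)
      then show ?thesis
        by (simp add: le_floor_iff floor_le_iff)
    qed
    then show ?thesis
      unfolding cell_def by auto
  qed
  then have "finite (cell ` {N..})"
    by (intro finite_subset[OF _ finite_PiE[OF F, of "\<lambda>_. {- int K..int K}"]]) auto
  then obtain R where R: "R \<subseteq> {N..}" "finite R" "cell ` {N..} = cell ` R"
    using finite_subset_image[of "cell ` {N..}" cell "{N..}"] by auto
  show ?thesis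
  proof
    fix m assume "m \<ge> N"
    then obtain r where r: "r \<in> R" "cell m = cell r"
      using R(3) by (metis atLeast_iff imageE imageI)
    have "\<bar>a m x - a r x\<bar> \<le> 1 / real K" if "x \<in> F" for x
    proof -
      have "\<lfloor>a m x * real K\<rfloor> = \<lfloor>a r x * real K\<rfloor>"
        using fun_cong[OF r(2), of x] that by (simp add: cell_def)
      then have "\<bar>a m x * real K - a r x * real K\<bar> \<le> 1"
        by linarith
      then have "\<bar>a m x - a r x\<bar> * real K \<le> 1"
        by (simp add: abs_mult flip: left_diff_distrib)
      then show ?thesis
        using K0 by (simp add: field_simps)
    qed
    then have "(\<Sum>x\<in>F. \<bar>a m x - a r x\<bar>) \<le> real (card F) * (1 / real K)"
      by (intro sum_bounded_above) auto
    also have "\<dots> < \<delta>"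
      using K K0 \<open>\<delta> > 0\<close> by (simp add: field_simps)
    also have "(\<Sum>x\<in>F. \<bar>a m x - a r x\<bar>) = mass (\<lambda>x. a m x - a r x) F"
      using F by (intro mass_superset[symmetric]) auto
    finally show "\<exists>r\<in>R. mass (\<lambda>x. a m x - a r x) F < \<delta>"
      using r(1) by blast
  qed (use R in auto)
qed

text \<open>
  The sequence \<open>a\<close> may converge on \<open>F\<close> to nonzero values, but differences of its terms can be made
  small on \<open>F\<close>. They keep a definite total mass if \<open>m\<close> is chosen only after the finite net \<open>R\<close>:
  take \<open>m\<close> such that \<open>a m\<close> has mass at least \<open>\<epsilon>\<close> off all atoms of the members of the net. There
  the difference to any member equals \<open>a m\<close>.
\<close>

lemma differences_leave_finite_sets:
  "\<exists>\<epsilon>>0. \<forall>F \<delta> N. finite F \<longrightarrow> \<delta> > 0 \<longrightarrow> (\<exists>m\<ge>N. \<exists>r\<ge>N.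
     mass (\<lambda>x. a m x - a r x) F < \<delta> \<and> \<epsilon> \<le> mass (\<lambda>x. a m x - a r x) UNIV)"
proof -
  obtain \<epsilon> where \<epsilon>: "\<epsilon> > 0" "\<And>F N. finite F \<Longrightarrow> \<exists>n\<ge>N. \<epsilon> \<le> mass (a n) (- F)"
    using no_concentration_on_finite_sets by blast
  show ?thesis
  proof (intro exI[of _ \<epsilon>] conjI allI impI \<epsilon>(1))
    fix F :: "'a set" and \<delta> :: real and N :: nat
    assume F: "finite F" "\<delta> > 0"
    obtain R where R: "finite R" "R \<subseteq> {N..}"
      "\<And>m. m \<ge> N \<Longrightarrow> \<exists>r\<in>R. mass (\<lambda>x. a m x - a r x) F < \<delta>"
      using finite_net[OF F, of N] by blast
    define G where "G = (\<Union>r\<in>R. atoms (a r))"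
    have "finite G"
      using R(1) by (simp add: G_def finite_atoms)
    then obtain m where m: "m \<ge> N" "\<epsilon> \<le> mass (a m) (- G)"
      using \<epsilon>(2) by blast
    obtain r where r: "r \<in> R" "mass (\<lambda>x. a m x - a r x) F < \<delta>"
      using R(3)[OF m(1)] by blast
    have "mass (a m) (- G) = mass (\<lambda>x. a m x - a r x) (- G)"
      using r(1) by (intro mass_cong) (auto simp: G_def atoms_def)
    also have "\<dots> \<le> mass (\<lambda>x. a m x - a r x) UNIV"
      by (intro mass_mono finite_subset[OF atoms_diff]) (auto simp: finite_atoms)
    finally show "\<exists>m\<ge>N. \<exists>r\<ge>N. mass (\<lambda>x. a m x - a r x) F < \<delta> \<and>
        \<epsilon> \<le> mass (\<lambda>x. a m x - a r x) UNIV"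
      using m r R(2) by force
  qed
qed

end

section \<open>Making the supports disjoint\<close>

lemma normalised_restriction:
  fixes d :: "'a \<Rightarrow> real"
  assumes fin: "finite (atoms d)" and w: "mass d (- G) > 0"
  defines "b \<equiv> \<lambda>x. if x \<in> G then 0 else d x / mass d (- G)"
  shows "atoms b = atoms d - G" and "mass b UNIV = 1"
    and "(\<And>x. x \<in> atoms d \<Longrightarrow> \<bar>f x\<bar> \<le> M) \<Longrightarrow>
      \<bar>pairing b f\<bar> \<le> (\<bar>pairing d f\<bar> + M * mass d G) / mass d (- G)"
proof -
  show at: "atoms b = atoms d - G"
    using w by (auto simp: b_def atoms_def)
  have "mass b UNIV = (\<Sum>x\<in>atoms d - G. \<bar>d x\<bar> / mass d (- G))"
    unfolding mass_def[of b] at using w by (intro sum.cong) (auto simp: b_def abs_divide)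
  also have "\<dots> = (\<Sum>x\<in>atoms d - G. \<bar>d x\<bar>) / mass d (- G)"
    by (simp add: sum_divide_distrib)
  also have "(\<Sum>x\<in>atoms d - G. \<bar>d x\<bar>) = mass d (- G)"
    by (simp add: mass_def Diff_eq)
  finally show "mass b UNIV = 1"
    using w by simp
  assume M: "\<And>x. x \<in> atoms d \<Longrightarrow> \<bar>f x\<bar> \<le> M"
  have "pairing d f = (\<Sum>x\<in>(atoms d - G) \<union> (atoms d \<inter> G). d x * f x)"
    unfolding pairing_def by (intro sum.cong) auto
  also have "\<dots> = (\<Sum>x\<in>atoms d - G. d x * f x) + (\<Sum>x\<in>atoms d \<inter> G. d x * f x)"
    using fin by (intro sum.union_disjoint) auto
  finally have split: "(\<Sum>x\<in>atoms d - G. d x * f x) = pairing d f - (\<Sum>x\<in>atoms d \<inter> G. d x * f x)"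
    by simp
  have "pairing b f = (\<Sum>x\<in>atoms d - G. d x * f x / mass d (- G))"
    unfolding pairing_def at by (intro sum.cong) (auto simp: b_def)
  then have "pairing b f = (\<Sum>x\<in>atoms d - G. d x * f x) / mass d (- G)"
    by (simp add: sum_divide_distrib)
  moreover have "\<bar>\<Sum>x\<in>atoms d \<inter> G. d x * f x\<bar> \<le> M * mass d G"
    unfolding mass_def sum_distrib_left using M
    by (intro order_trans[OF sum_abs] sum_mono) (auto simp: abs_mult mult.commute[of M] mult_left_mono)
  ultimately show "\<bar>pairing b f\<bar> \<le> (\<bar>pairing d f\<bar> + M * mass d G) / mass d (- G)"
    using w unfolding split by (simp add: abs_divide divide_right_mono)
qed

text \<open>
  A gliding hump. The finite set \<open>G i\<close> collects all atoms used before stage \<open>i\<close>. A difference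
  \<open>d i\<close> of two late terms is chosen with mass below \<open>\<delta> i\<close> on \<open>G i\<close> and total mass at least \<open>\<epsilon>\<close>,
  restricted to the complement of \<open>G i\<close>, and normalised. A continuous \<open>f\<close> is bounded by some \<open>M\<close> on
  all atoms, so the discarded part contributes at most \<open>M * \<delta> i\<close> to the pairing of \<open>d i\<close> with \<open>f\<close>, and
  normalising divides this by at least \<open>\<epsilon> / 2\<close>.
\<close>

lemma (in atomic_JN) disjoint_atomic_JN:
  "\<exists>b. atomic_JN X b \<and> (\<forall>n n'. n \<noteq> n' \<longrightarrow> atoms (b n) \<inter> atoms (b n') = {})"
proof -
  obtain \<epsilon> where \<epsilon>: "\<epsilon> > 0"
    "\<And>F \<delta> N. finite F \<Longrightarrow> \<delta> > 0 \<Longrightarrow> \<exists>m\<ge>N. \<exists>r\<ge>N.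
       mass (\<lambda>x. a m x - a r x) F < \<delta> \<and> \<epsilon> \<le> mass (\<lambda>x. a m x - a r x) UNIV"
    using differences_leave_finite_sets by blast
  define \<delta> where "\<delta> = (\<lambda>i. (\<epsilon> / 2) / real (Suc i))"
  have \<delta>: "\<delta> i > 0" "\<delta> i \<le> \<epsilon> / 2" for i
    using \<epsilon>(1) by (auto simp: \<delta>_def field_simps)
  have "\<delta> \<longlonglongrightarrow> 0"
    unfolding \<delta>_def by (rule LIMSEQ_Suc[OF lim_const_over_n])
  \<comment> \<open>\<open>p F i\<close> is a pair of indices of terms whose difference is suitable at stage \<open>i\<close>, where \<open>F\<close> is
    the set of atoms already used.\<close>
  define good where "good = (\<lambda>F i p. i \<le> fst p \<and> i \<le> snd p \<and>
      mass (\<lambda>x. a (fst p) x - a (snd p) x) F < \<delta> i \<and>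
      \<epsilon> \<le> mass (\<lambda>x. a (fst p) x - a (snd p) x) UNIV)"
  have "\<exists>p. good F i p" if "finite F" for F i
    using \<epsilon>(2)[OF that \<delta>(1), of i i] by (auto simp: good_def)
  then obtain p where p: "\<And>F i. finite F \<Longrightarrow> good F i (p F i)"
    by metis
  define G where "G = rec_nat {} (\<lambda>i S. S \<union> (atoms (a (fst (p S i))) \<union> atoms (a (snd (p S i)))))"
  define m r where "m = (\<lambda>i. fst (p (G i) i))" and "r = (\<lambda>i. snd (p (G i) i))"
  define d where "d = (\<lambda>i x. a (m i) x - a (r i) x)"
  have G_Suc: "G (Suc i) = G i \<union> (atoms (a (m i)) \<union> atoms (a (r i)))" for i
    by (simp add: G_def m_def r_def)
  have "finite (G i)" for i
    by (induction i) (simp_all add: G_Suc finite_atoms, simp add: G_def)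
  from p[OF this] have mr: "i \<le> m i" "i \<le> r i" "mass (d i) (G i) < \<delta> i" "\<epsilon> \<le> mass (d i) UNIV" for i
    by (simp_all add: good_def m_def r_def d_def)
  have d_atoms: "atoms (d i) \<subseteq> atoms (a (m i)) \<union> atoms (a (r i))" for i
    unfolding d_def by (rule atoms_diff)
  have d_fin: "finite (atoms (d i))" for i
    using finite_subset[OF d_atoms] finite_atoms by simp
  have w: "\<epsilon> / 2 \<le> mass (d i) (- G i)" for i
    using mass_compl[OF d_fin, of i "G i"] mr(3,4)[of i] \<delta>(2)[of i] by linarith
  then have w0: "0 < mass (d i) (- G i)" for i
    using \<epsilon>(1) by (meson half_gt_zero less_le_trans)
  define b where "b = (\<lambda>i x. if x \<in> G i then 0 else d i x / mass (d i) (- G i))"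
  have b_atoms: "atoms (b i) = atoms (d i) - G i"
    and b_mass: "mass (b i) UNIV = 1"
    and b_pairing: "(\<And>x. x \<in> atoms (d i) \<Longrightarrow> \<bar>f x\<bar> \<le> M) \<Longrightarrow>
      \<bar>pairing (b i) f\<bar> \<le> (\<bar>pairing (d i) f\<bar> + M * mass (d i) (G i)) / mass (d i) (- G i)" for i f M
    unfolding b_def by (rule normalised_restriction[OF d_fin w0]; assumption)+
  have G_mono: "mono G"
    by (simp add: mono_iff_le_Suc G_Suc)
  have "atoms (b i) \<inter> atoms (b j) = {}" if "i < j" for i j
  proof -
    have "atoms (b i) \<subseteq> G (Suc i)"
      using d_atoms[of i] by (auto simp: b_atoms G_Suc)
    also have "\<dots> \<subseteq> G j"
      using G_mono that by (simp add: monoD)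
    finally show ?thesis
      by (auto simp: b_atoms)
  qed
  then have disj: "\<forall>i j. i \<noteq> j \<longrightarrow> atoms (b i) \<inter> atoms (b j) = {}"
    by (metis Int_commute nat_neq_iff)
  have "atomic_JN X b"
  proof
    fix i
    show "finite (atoms (b i))"
      by (simp add: b_atoms d_fin)
    show "atoms (b i) \<subseteq> topspace X"
      using d_atoms[of i] atoms_topspace by (fastforce simp: b_atoms)
  next
    fix f assume f: "continuous_map X euclideanreal f"
    obtain M where M: "\<And>n x. x \<in> atoms (a n) \<Longrightarrow> \<bar>f x\<bar> \<le> M"
      using continuous_bounded_on_atoms[OF f] by blast
    have M': "\<bar>f x\<bar> \<le> \<bar>M\<bar>" if "x \<in> atoms (d i)" for i x
      using d_atoms[of i] that M by fastforce
    define B where "B = (\<lambda>i. (\<bar>pairing (a (m i)) f\<bar> + \<bar>pairing (a (r i)) f\<bar> + \<bar>M\<bar> * \<delta> i) / (\<epsilon> / 2))"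
    have bound: "norm (pairing (b i) f) \<le> B i" for i
    proof -
      have "\<bar>pairing (b i) f\<bar> \<le> (\<bar>pairing (d i) f\<bar> + \<bar>M\<bar> * mass (d i) (G i)) / mass (d i) (- G i)"
        by (rule b_pairing) (rule M')
      also have "\<dots> \<le> (\<bar>pairing (d i) f\<bar> + \<bar>M\<bar> * \<delta> i) / (\<epsilon> / 2)"
        using \<epsilon>(1) w[of i] mr(3)[of i] \<delta>(1)[of i]
        by (intro frac_le add_left_mono mult_left_mono add_nonneg_nonneg) auto
      also have "\<dots> \<le> B i"
        unfolding B_def d_def pairing_diff[OF finite_atoms finite_atoms] using \<epsilon>(1)
        by (intro divide_right_mono add_right_mono abs_triangle_ineq4) auto
      finally show ?thesis by simp
    qed
    have "B \<longlonglongrightarrow> (\<bar>0\<bar> + \<bar>0\<bar> + \<bar>M\<bar> * 0) / (\<epsilon> / 2)"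
    proof -
      have m: "filterlim m at_top sequentially" and r: "filterlim r at_top sequentially"
        using mr by (intro filterlim_at_top_mono[OF filterlim_ident] always_eventually allI; simp)+
      show ?thesis
        unfolding B_def
        using filterlim_compose[OF null[OF f] m] filterlim_compose[OF null[OF f] r] \<epsilon>(1) \<open>\<delta> \<longlonglongrightarrow> 0\<close>
        by (intro tendsto_intros) auto
    qed
    then have "B \<longlonglongrightarrow> 0"
      by simp
    with always_eventually[OF allI[OF bound]] show "(\<lambda>i. pairing (b i) f) \<longlonglongrightarrow> 0"
      by (rule Lim_null_comparison)
  qed (use Tychonoff b_mass in auto)
  then show ?thesis
    using disj by blast
qed

section \<open>Passage between measures and coefficients\<close>

lemma atomic_JN_imp_fsJN:
  assumes "atomic_JN X a"
  shows "fsJN_sequence X (\<lambda>n. atomic_measure (a n)) \<and> (\<forall>n. supp X (atomic_measure (a n)) = atoms (a n))"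
proof -
  interpret atomic_JN X a by fact
  have X: "Hausdorff_space X"
    using Tychonoff by (simp add: Tychonoff_space_def)
  note atomic = X finite_atoms atoms_topspace
  have "mass (a n) (topspace X) = 1" for n
    using mass_one[of n] atoms_topspace[of n] by (simp add: mass_def Int_absorb2)
  then show ?thesis
    unfolding fsJN_sequence_def JN_sequence_def variation_norm_def
    using atomic_radon[OF atomic] atomic_variation[OF atomic] atomic_supp[OF atomic]
      atomic_signed_integral[OF atomic] null finite_atoms by simp
qed

lemma fsJN_imp_atomic_JN:
  assumes X: "Tychonoff_space X" and \<mu>: "fsJN_sequence X \<mu>"
  shows "\<exists>a. atomic_JN X a"
proof -
  have H: "Hausdorff_space X"
    using X by (simp add: Tychonoff_space_def)
  have radon: "signed_radon_measure X (\<mu> n)" and norm: "variation_norm X (\<mu> n) = 1"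
    and fin: "finite (supp X (\<mu> n))" for n
    using \<mu> by (auto simp: fsJN_sequence_def JN_sequence_def)
  define a where "a = (\<lambda>n x. if x \<in> supp X (\<mu> n) then \<mu> n {x} else 0)"
  have eq: "\<mu> n E = atomic_measure (a n) E" if "E \<in> sets (borel_of X)" for n E
    unfolding a_def by (rule finite_supp_imp_atomic[OF H radon fin that])
  have at: "atoms (a n) \<subseteq> supp X (\<mu> n)" for n
    by (auto simp: a_def atoms_def)
  have atomic: "finite (atoms (a n))" "atoms (a n) \<subseteq> topspace X" for n
    using at[of n] fin[of n] by (auto simp: supp_def dest: finite_subset)
  have "atomic_JN X a"
  proof
    fix n
    have "variation X (\<mu> n) (topspace X) = ennreal (mass (a n) (topspace X))"
      using variation_cong[where \<mu>="\<mu> n" and \<nu>="atomic_measure (a n)", OF eq]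
        atomic_variation[OF H atomic] by simp
    then have "ennreal (mass (a n) (topspace X)) = 1"
      using norm[of n] by (simp add: variation_norm_def)
    then show "mass (a n) UNIV = 1"
      using atomic(2)[of n] by (simp add: mass_def Int_absorb2)
  next
    fix f assume f: "continuous_map X euclideanreal f"
    have integral: "signed_integral X (\<mu> n) f = pairing (a n) f" for n
      using signed_integral_cong[where \<mu>="\<mu> n" and \<nu>="atomic_measure (a n)", OF eq]
        atomic_signed_integral(2)[OF H atomic f] by simp
    show "(\<lambda>n. pairing (a n) f) \<longlonglongrightarrow> 0"
      using \<mu> f by (simp add: fsJN_sequence_def JN_sequence_def flip: integral)
  qed (use X atomic in auto)
  then show ?thesis by blast
qed

theorem theorem4p22:
  fixes X :: "'a topology"
  assumes "Tychonoff_space X"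
    and "fsJNP X"
  shows "\<exists>\<mu> :: nat \<Rightarrow> 'a set \<Rightarrow> real. fsJN_sequence X \<mu> \<and>
           (\<forall>n n'. n \<noteq> n' \<longrightarrow> supp X (\<mu> n) \<inter> supp X (\<mu> n') = {})"
proof -
  obtain a where "atomic_JN X a"
    using assms fsJN_imp_atomic_JN by (auto simp: fsJNP_def)
  then obtain b where b: "atomic_JN X b" "\<forall>n n'. n \<noteq> n' \<longrightarrow> atoms (b n) \<inter> atoms (b n') = {}"
    using atomic_JN.disjoint_atomic_JN by blast
  then show ?thesis
    using atomic_JN_imp_fsJN[OF b(1)] by (intro exI[of _ "\<lambda>n. atomic_measure (b n)"]) simp
qed

end
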